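(* Let $(\mathscr{H},d)$ be a Hadamard space satisfying the $(\overline{Q_4})$ condition, let $C$ be a nonempty, closed and convex subset of $\mathscr{H}$, and let $T:C\to C$ be a nonexpansive mapping with $F(T)\neq\emptyset$. Let $P$ denote the metric projection onto $F(T)$. Then for every $x\in C$ the sequence $\{T^nx\}$ is $\triangle$-mean convergent to a fixed point of $T$ (that is, the sequence of Karcher means $\sigma_n(x)$ of $x,Tx,\ldots,T^{n-1}x$ $\triangle$-converges, as $n\to\infty$, to a point of $F(T)$), and this fixed point is also the strong limit (limit in the metric $d$) of the sequence $\{PT^nx\}$.
   Context: A Hadamard space is a complete $CAT(0)$ space. It is uniquely geodesic; $[x,y]$ denotes the geodesic segment between $x$ and $y$. A subset $C$ is convex if $[x,y]\subset C$ for all $x,y\in C$. $(\overline{Q_4})$ condition: for all points $x,y,p,q\in\mathscr{H}$ and every point $m\in[x,y]$, if $d(p,x)\leqslant d(x,q)$ and $d(p,y)\leqslant d(y,q)$, then $d(p,m)\leqslant d(m,q)$. A mapping $T$ is nonexpansive if $d(Tx,Ty)\leqslant d(x,y)$ for all $x,y$ in its domain. $F(T)=\{x: Tx=x\}$ is its fixed point set; it is closed and convex. For a nonempty closed convex set $S\subset\mathscr{H}$, the metric projection onto $S$ sends $x\in\mathscr H$ to the unique point of $S$ nearest to $x$. $\triangle$-convergence: for a bounded sequence $\{x_n\}$ in $\mathscr{H}$ put $r(x,\{x_n\})=\limsup_{n\to\infty}d(x,x_n)$ and $r(\{x_n\})=\inf_{x\in\mathscr{H}}r(x,\{x_n\})$.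 The asymptotic center is $A(\{x_n\})=\{x\in\mathscr{H}: r(x,\{x_n\})=r(\{x_n\})\}$, which is a singleton in a Hadamard space. The sequence $\{x_n\}$ $\triangle$-converges to $x$ if $A(\{x_{n_k}\})=\{x\}$ for every subsequence $\{x_{n_k}\}$ of $\{x_n\}$. Karcher mean: for $n\geqslant 1$, $\sigma_n(x)$ is the unique minimizer over $y\in\mathscr{H}$ of the function $y\mapsto\frac1n\sum_{i=0}^{n-1}d^2(T^ix,y)$. The sequence $\{T^nx\}$ is called $\triangle$-mean convergent to $p$ if $\sigma_n(x)$ $\triangle$-converges to $p$ as $n\to\infty$. *)

theory Defs
  imports "HOL-Analysis.Analysis"
begin

section \<open>CAT(0) spaces\<close>

definition geodesic_segment :: "'a::metric_space set \<Rightarrow> 'a \<Rightarrow> 'a \<Rightarrow> bool" where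
  "geodesic_segment S x y \<longleftrightarrow>
     (\<exists>c :: real \<Rightarrow> 'a. c 0 = x \<and> c (dist x y) = y \<and>
        (\<forall>s\<in>{0..dist x y}. \<forall>t\<in>{0..dist x y}. dist (c s) (c t) = \<bar>s - t\<bar>) \<and>
        S = c ` {0..dist x y})"

definition geodesic_space :: "'a::metric_space itself \<Rightarrow> bool" where
  "geodesic_space TYPE('a) \<longleftrightarrow> (\<forall>x y :: 'a. \<exists>S. geodesic_segment S x y)"

text \<open>The pairs of a point of the side \<open>S\<close> from \<open>x\<close> to \<open>y\<close> and its comparison point on the
  Euclidean side from \<open>x'\<close> to \<open>y'\<close>.\<close>

definition side_comparison ::
    "'a::metric_space set \<Rightarrow> 'a \<Rightarrow> 'a \<Rightarrow> real^2 \<Rightarrow> real^2 \<Rightarrow> ('a \<times> (real^2)) set" where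
  "side_comparison S x y x' y' =
     {(p, p'). p \<in> S \<and> p' \<in> closed_segment x' y' \<and> dist x' p' = dist x p}"

definition comparison_triangle ::
    "'a::metric_space \<Rightarrow> 'a \<Rightarrow> 'a \<Rightarrow> real^2 \<Rightarrow> real^2 \<Rightarrow> real^2 \<Rightarrow> bool" where
  "comparison_triangle x y z x' y' z' \<longleftrightarrow>
     dist x' y' = dist x y \<and> dist y' z' = dist y z \<and> dist z' x' = dist z x"

text \<open>No geodesic triangle is thicker than its Euclidean comparison triangle.\<close>

definition CAT0 :: "'a::metric_space itself \<Rightarrow> bool" where
  "CAT0 TYPE('a) \<longleftrightarrow> geodesic_space TYPE('a) \<and>
     (\<forall>(x::'a) y z Sxy Syz Szx x' y' z'.
        geodesic_segment Sxy x y \<and> geodesic_segment Syz y z \<and> geodesic_segment Szx z x \<and>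
        comparison_triangle x y z x' y' z' \<longrightarrow>
        (let K = side_comparison Sxy x y x' y' \<union> side_comparison Syz y z y' z' \<union>
                 side_comparison Szx z x z' x'
         in \<forall>(p, p')\<in>K. \<forall>(q, q')\<in>K. dist p q \<le> dist p' q'))"

text \<open>In a CAT(0) space the geodesic segment joining two points is unique, so that quantifying
  over all geodesic segments \<open>S\<close> from \<open>x\<close> to \<open>y\<close> below is the same as speaking of \<open>[x,y]\<close>.\<close>

definition geodesically_convex :: "'a::metric_space set \<Rightarrow> bool" where
  "geodesically_convex C \<longleftrightarrow>
     (\<forall>x\<in>C. \<forall>y\<in>C. \<forall>S. geodesic_segment S x y \<longrightarrow> S \<subseteq> C)"

definition Q4_bar :: "'a::metric_space itself \<Rightarrow> bool" where
  "Q4_bar TYPE('a) \<longleftrightarrow>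
     (\<forall>(x::'a) y p q S. geodesic_segment S x y \<longrightarrow>
        (\<forall>m\<in>S. dist p x \<le> dist x q \<and> dist p y \<le> dist y q \<longrightarrow> dist p m \<le> dist m q))"

section \<open>Nonexpansive mappings and projections\<close>

definition nonexpansive_on :: "'a::metric_space set \<Rightarrow> ('a \<Rightarrow> 'a) \<Rightarrow> bool" where
  "nonexpansive_on C T \<longleftrightarrow> (\<forall>x\<in>C. \<forall>y\<in>C. dist (T x) (T y) \<le> dist x y)"

definition fixed_points :: "'a set \<Rightarrow> ('a \<Rightarrow> 'a) \<Rightarrow> 'a set" where
  "fixed_points C T = {x \<in> C. T x = x}"

text \<open>Well defined when \<open>S\<close> is a nonempty closed convex subset of a Hadamard space.\<close>

definition metric_projection :: "'a::metric_space set \<Rightarrow> 'a \<Rightarrow> 'a" where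
  "metric_projection S x = (THE y. y \<in> S \<and> (\<forall>z\<in>S. dist x y \<le> dist x z))"

section \<open>Delta-convergence\<close>

text \<open>The radii are taken in \<^typ>\<open>ereal\<close>, where limits superior and infima always exist; they
  are finite for bounded sequences.\<close>

definition asymptotic_radius_at :: "'a::metric_space \<Rightarrow> (nat \<Rightarrow> 'a) \<Rightarrow> ereal" where
  "asymptotic_radius_at x u = limsup (\<lambda>n. ereal (dist x (u n)))"

definition asymptotic_radius :: "(nat \<Rightarrow> 'a::metric_space) \<Rightarrow> ereal" where
  "asymptotic_radius u = (INF x. asymptotic_radius_at x u)"

definition asymptotic_center :: "(nat \<Rightarrow> 'a::metric_space) \<Rightarrow> 'a set" where
  "asymptotic_center u = {x. asymptotic_radius_at x u = asymptotic_radius u}"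

definition Delta_converges :: "(nat \<Rightarrow> 'a::metric_space) \<Rightarrow> 'a \<Rightarrow> bool" where
  "Delta_converges u x \<longleftrightarrow> bounded (range u) \<and>
     (\<forall>k :: nat \<Rightarrow> nat. strict_mono k \<longrightarrow> asymptotic_center (u \<circ> k) = {x})"

section \<open>Karcher means\<close>

definition karcher_functional :: "('a::metric_space \<Rightarrow> 'a) \<Rightarrow> nat \<Rightarrow> 'a \<Rightarrow> 'a \<Rightarrow> real" where
  "karcher_functional T n x y = (1 / real n) * (\<Sum>i<n. (dist ((T ^^ i) x) y)\<^sup>2)"

text \<open>Meaningful for \<open>n \<ge> 1\<close> only.\<close>

definition karcher_mean :: "('a::metric_space \<Rightarrow> 'a) \<Rightarrow> nat \<Rightarrow> 'a \<Rightarrow> 'a" where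
  "karcher_mean T n x =
     (THE y. \<forall>z. karcher_functional T n x y \<le> karcher_functional T n x z)"

text \<open>The sequence of means starts at \<open>n = 1\<close>, hence the shift by \<^const>\<open>Suc\<close>.\<close>

definition Delta_mean_convergent :: "('a::metric_space \<Rightarrow> 'a) \<Rightarrow> 'a \<Rightarrow> 'a \<Rightarrow> bool" where
  "Delta_mean_convergent T x p \<longleftrightarrow> Delta_converges (\<lambda>n. karcher_mean T (Suc n) x) p"

end

theory Submission
  imports Defs
begin

text \<open>
  Squared distances, Karcher functionals and squared asymptotic radii are all strongly convex
  along geodesics, so over a closed convex set each has a minimizer \<open>s\<close> with
  \<open>f s + d(s, y)\<^sup>2 \<le> f y\<close>. Comparing the Karcher functional at \<open>\<sigma>\<^sub>n\<close> and at \<open>T \<sigma>\<^sub>n\<close> gives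
  \<open>d(\<sigma>\<^sub>n, T \<sigma>\<^sub>n)\<^sup>2 = O(1/n)\<close>, so the asymptotic center \<open>z\<close> of every subsequence of the means is
  a fixed point. The projections of the orbit onto the fixed points form a Cauchy sequence with
  limit \<open>p\<close>. If \<open>z \<noteq> p\<close>, the orbit eventually stays in \<open>D = {y. d(p, y) \<le> d(z, y)}\<close>, which is
  convex by the \<open>Q\<^sub>4\<close> condition. Replacing \<open>\<sigma>\<^sub>n\<close> by its projection onto \<open>D\<close> then raises the
  Karcher functional by at most \<open>O(1/n)\<close>, so the means approach \<open>D\<close>. Hence \<open>p\<close> is an
  asymptotic center as well, contradicting uniqueness.
\<close>

section \<open>Comparison with Euclidean triangles\<close>

text \<open>\<open>CAT0\<close> only speaks of given comparison triangles, so one must be produced.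
  Put \<open>x'\<close> at the origin and \<open>y'\<close> on the first axis; the law of cosines
  determines the first coordinate \<open>u\<close> of \<open>z'\<close>, and the triangle inequality
  leaves room for a real second coordinate.\<close>

lemma comparison_triangle_exists:
  fixes x y z :: "'a::metric_space"
  shows "\<exists>x' y' z'. comparison_triangle x y z x' y' z'"
proof -
  define a b c where "a = dist x y" and "b = dist y z" and "c = dist z x"
  have nn: "a \<ge> 0" "b \<ge> 0" "c \<ge> 0"
    and tri: "a \<le> b + c" "b \<le> a + c" "c \<le> a + b"
    using dist_triangle[of x y z] dist_triangle[of y z x] dist_triangle[of z x y]
    by (simp_all add: a_def b_def c_def dist_commute)
  obtain u v :: real where uv: "u\<^sup>2 + v\<^sup>2 = c\<^sup>2" "(a - u)\<^sup>2 + v\<^sup>2 = b\<^sup>2"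
  proof (cases "a = 0")
    case True
    then have "b = c" using tri by simp
    then show ?thesis using that[of c 0] True by simp
  next
    case False
    define u where "u = (a\<^sup>2 + c\<^sup>2 - b\<^sup>2) / (2 * a)"
    have au: "2 * a * u = a\<^sup>2 + c\<^sup>2 - b\<^sup>2" using False by (simp add: u_def)
    \<comment> \<open>The bounds |a - c| \<le> b \<le> a + c say precisely that the cosine at
      \<open>x'\<close> lies between -1 and 1.\<close>
    have "(a - c)\<^sup>2 \<le> b\<^sup>2" using tri nn by (intro abs_le_square_iff[THEN iffD1]) auto
    moreover have "b\<^sup>2 \<le> (a + c)\<^sup>2" using tri nn by (intro power_mono) auto
    ultimately have "\<bar>2 * a * u\<bar> \<le> 2 * a * c"
      unfolding au by (auto simp: power2_eq_square algebra_simps abs_le_iff)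
    then have "a * \<bar>u\<bar> \<le> a * c" using nn by (simp add: abs_mult)
    then have "\<bar>u\<bar> \<le> \<bar>c\<bar>" using False nn by (simp add: mult_le_cancel_left)
    then have "u\<^sup>2 \<le> c\<^sup>2" by (simp add: abs_le_square_iff)
    then show ?thesis using au by (intro that[of u "sqrt (c\<^sup>2 - u\<^sup>2)"]) (auto simp: power2_diff)
  qed
  define x' y' z' :: "real^2" where "x' = 0" and "y' = vector [a, 0]" and "z' = vector [u, v]"
  have "dist x' y' = a"
    using nn by (simp add: x'_def y'_def dist_norm norm_eq_sqrt_inner inner_vec_def sum_2)
  moreover have "dist y' z' = b"
    using nn uv(2) by (simp add: y'_def z'_def dist_norm norm_eq_sqrt_inner inner_vec_def sum_2
        flip: power2_eq_square)
  moreover have "dist z' x' = c"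
    using nn uv(1) by (simp add: x'_def z'_def dist_norm norm_eq_sqrt_inner inner_vec_def sum_2
        flip: power2_eq_square)
  ultimately show ?thesis unfolding comparison_triangle_def a_def b_def c_def by blast
qed

text \<open>This is Stewart's theorem, the Euclidean equality that turns into an inequality in
  CAT(0) spaces.\<close>

lemma dist_convex_combination_squared:
  fixes x y z :: "'a::real_inner"
  shows "(dist z ((1 - t) *\<^sub>R x + t *\<^sub>R y))\<^sup>2 =
    (1 - t) * (dist z x)\<^sup>2 + t * (dist z y)\<^sup>2 - t * (1 - t) * (dist x y)\<^sup>2"
proof -
  have z: "z - ((1 - t) *\<^sub>R x + t *\<^sub>R y) = (1 - t) *\<^sub>R (z - x) + t *\<^sub>R (z - y)"
    by (simp add: algebra_simps)
  have xy: "x - y = (z - y) - (z - x)" by simp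
  show ?thesis
    unfolding dist_norm z xy power2_norm_eq_inner
    by (simp add: inner_diff_left inner_diff_right inner_add_left inner_add_right
        inner_commute[of "z - y" "z - x"] del: diff_diff_eq2 diff_diff_eq)
       (simp add: algebra_simps)
qed

section \<open>Points of geodesic segments and strong convexity along them\<close>

lemma geodesic_segment_endpoints:
  assumes "geodesic_segment S x y"
  shows "x \<in> S" "y \<in> S"
proof -
  obtain c where "c 0 = x" "c (dist x y) = y" "S = c ` {0..dist x y}"
    using assms unfolding geodesic_segment_def by blast
  then show "x \<in> S" "y \<in> S" by (metis atLeastAtMost_iff imageI order_refl zero_le_dist)+
qed

lemma geodesic_segment_point:
  assumes "geodesic_segment S x y" "0 \<le> t" "t \<le> 1"
  obtains m where "m \<in> S" "dist x m = t * dist x y"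
proof -
  obtain c where c: "c 0 = x" "S = c ` {0..dist x y}"
    "\<And>s t. s \<in> {0..dist x y} \<Longrightarrow> t \<in> {0..dist x y} \<Longrightarrow> dist (c s) (c t) = \<bar>s - t\<bar>"
    using assms(1) unfolding geodesic_segment_def by blast
  have "t * dist x y \<in> {0..dist x y}" using assms(2,3) by (simp add: mult_left_le_one_le)
  then show ?thesis using c assms(2) c(3)[of 0 "t * dist x y"] by (intro that[of "c (t * dist x y)"]) auto
qed

lemma geodesic_segment_parameter:
  assumes "geodesic_segment S x y" "m \<in> S"
  obtains t where "0 \<le> t" "t \<le> 1" "dist x m = t * dist x y" "dist m y = (1 - t) * dist x y"
proof -
  obtain c where c: "c 0 = x" "c (dist x y) = y" "S = c ` {0..dist x y}"
    "\<And>s t. s \<in> {0..dist x y} \<Longrightarrow> t \<in> {0..dist x y} \<Longrightarrow> dist (c s) (c t) = \<bar>s - t\<bar>"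
    using assms(1) unfolding geodesic_segment_def by blast
  obtain s where s: "s \<in> {0..dist x y}" "m = c s" using assms(2) c(3) by blast
  have d: "dist x m = s" "dist m y = dist x y - s"
    using c(4)[of 0 s] c(4)[of s "dist x y"] s c(1,2) by auto
  show ?thesis
  proof (cases "dist x y = 0")
    case True
    then show ?thesis using that[of 0] d s by auto
  next
    case False
    then show ?thesis using d s by (intro that[of "s / dist x y"]) (auto simp: left_diff_distrib)
  qed
qed

text \<open>The quadratic term is normalized so that the squared distance to a point of the
  Euclidean plane attains equality. The intermediate point is specified by its distance from
  \<open>x\<close>, which avoids choosing a parametrization of the segment.\<close>

definition strongly_convex :: "('a::metric_space \<Rightarrow> real) \<Rightarrow> bool" where
  "strongly_convex f \<longleftrightarrow>
     (\<forall>x y S m t. geodesic_segment S x y \<and> m \<in> S \<and> 0 \<le> t \<and> t \<le> 1 \<and> dist x m = t * dist x y \<longrightarrow>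
        f m \<le> (1 - t) * f x + t * f y - t * (1 - t) * (dist x y)\<^sup>2)"

lemma strongly_convexD:
  assumes "strongly_convex f" "geodesic_segment S x y" "m \<in> S" "0 \<le> t" "t \<le> 1"
    "dist x m = t * dist x y"
  shows "f m \<le> (1 - t) * f x + t * f y - t * (1 - t) * (dist x y)\<^sup>2"
  using assms unfolding strongly_convex_def by blast

lemma CAT0_geodesic_space: "CAT0 TYPE('a::metric_space) \<Longrightarrow> geodesic_space TYPE('a)"
  unfolding CAT0_def by blast

text \<open>The Bruhat-Tits (CN) inequality: in the triangle \<open>x\<close>, \<open>y\<close>,
  \<open>z\<close>, the distance from \<open>z\<close> to a point of the opposite side is at most
  the Euclidean one, which Stewart's theorem computes.\<close>

lemma CAT0_strongly_convex_dist:
  assumes "CAT0 TYPE('a::metric_space)"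
  shows "strongly_convex (\<lambda>y. (dist (z::'a) y)\<^sup>2)"
  unfolding strongly_convex_def
proof (intro allI impI, elim conjE)
  fix x y m :: 'a and S t
  assume S: "geodesic_segment S x y" and m: "m \<in> S" and t: "0 \<le> t" "t \<le> 1"
    and d: "dist x m = t * dist x y"
  obtain Syz where yz: "geodesic_segment Syz y z"
    using assms unfolding CAT0_def geodesic_space_def by blast
  obtain Szx where zx: "geodesic_segment Szx z x"
    using assms unfolding CAT0_def geodesic_space_def by blast
  obtain x' y' z' where tri: "comparison_triangle x y z x' y' z'"
    using comparison_triangle_exists by blast
  define m' where "m' = (1 - t) *\<^sub>R x' + t *\<^sub>R y'"
  have "x' - m' = t *\<^sub>R (x' - y')" by (simp add: m'_def algebra_simps)
  then have "dist x' m' = dist x m"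
    using t d tri by (simp add: dist_norm comparison_triangle_def)
  moreover have "m' \<in> closed_segment x' y'" using t by (auto simp: m'_def closed_segment_def)
  ultimately have mK: "(m, m') \<in> side_comparison S x y x' y'"
    using m by (simp add: side_comparison_def)
  \<comment> \<open>The vertex \<open>z\<close> is compared as the endpoint of the side from
    \<open>y\<close> to \<open>z\<close>.\<close>
  have zK: "(z, z') \<in> side_comparison Syz y z y' z'"
    using geodesic_segment_endpoints[OF yz] tri
    by (simp add: side_comparison_def comparison_triangle_def)
  have "\<forall>(p, p')\<in>side_comparison S x y x' y' \<union> side_comparison Syz y z y' z' \<union>
                 side_comparison Szx z x z' x'.
        \<forall>(q, q')\<in>side_comparison S x y x' y' \<union> side_comparison Syz y z y' z' \<union>
                 side_comparison Szx z x z' x'. dist p q \<le> dist p' q'"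
    using assms S yz zx tri unfolding CAT0_def Let_def by blast
  then have "dist z m \<le> dist z' m'" using mK zK by blast
  then have "(dist z m)\<^sup>2 \<le> (dist z' m')\<^sup>2" by (simp add: power_mono)
  also have "\<dots> = (1 - t) * (dist z x)\<^sup>2 + t * (dist z y)\<^sup>2 - t * (1 - t) * (dist x y)\<^sup>2"
    using tri unfolding m'_def dist_convex_combination_squared
    by (simp add: comparison_triangle_def dist_commute)
  finally show "(dist z m)\<^sup>2 \<le> (1 - t) * (dist z x)\<^sup>2 + t * (dist z y)\<^sup>2 - t * (1 - t) * (dist x y)\<^sup>2" .
qed

lemma power2_add_le_imp_le:
  fixes a b c :: "'a::linordered_idom"
  assumes "a\<^sup>2 + b\<^sup>2 \<le> c\<^sup>2" "0 \<le> c"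
  shows "a \<le> c" "b \<le> c"
proof -
  have "a\<^sup>2 \<le> c\<^sup>2" "b\<^sup>2 \<le> c\<^sup>2"
    using assms(1) by (auto intro: order_trans[rotated])
  then show "a \<le> c" "b \<le> c" using assms(2) by (auto intro: power2_le_imp_le)
qed

lemma power2_add_le_imp_eq_0:
  fixes a b c :: "'a::linordered_idom"
  assumes "a\<^sup>2 + b\<^sup>2 \<le> c\<^sup>2" "c\<^sup>2 \<le> a\<^sup>2"
  shows "b = 0"
proof -
  have "a\<^sup>2 + b\<^sup>2 \<le> a\<^sup>2" using assms by (rule order_trans)
  then show ?thesis by simp
qed

section \<open>Minimizers of strongly convex functions\<close>

text \<open>Midpoints of near-minimizers would fall below the infimum unless the near-minimizers are
  close, so a minimizing sequence is Cauchy. The quadratic growth away from \<open>s\<close> also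
  yields uniqueness in every application.\<close>

lemma strongly_convex_minimizer:
  fixes D :: "'a::complete_space set"
  assumes geo: "geodesic_space TYPE('a)" and D: "closed D" "geodesically_convex D" "D \<noteq> {}"
    and f: "strongly_convex f" "continuous_on UNIV f" and nonneg: "\<And>y. 0 \<le> f y"
  shows "\<exists>s\<in>D. \<forall>y\<in>D. f s + (dist s y)\<^sup>2 \<le> f y"
proof -
  have inner: "\<exists>m\<in>D. f m \<le> (1 - t) * f y + t * f w - t * (1 - t) * (dist y w)\<^sup>2"
    if yw: "y \<in> D" "w \<in> D" and t: "0 \<le> t" "t \<le> 1" for y w t
  proof -
    obtain S where S: "geodesic_segment S y w" using geo unfolding geodesic_space_def by blast
    obtain m where m: "m \<in> S" "dist y m = t * dist y w" using geodesic_segment_point[OF S t] .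
    have "m \<in> D" using D(2) yw S m(1) unfolding geodesically_convex_def by blast
    then show ?thesis using strongly_convexD[OF f(1) S m(1) t m(2)] by blast
  qed
  define \<mu> where "\<mu> = (INF y\<in>D. f y)"
  have bdd: "bdd_below (f ` D)" using nonneg by (intro bdd_belowI[of _ 0]) auto
  have \<mu>: "\<mu> \<le> f y" if "y \<in> D" for y unfolding \<mu>_def using bdd that by (rule cINF_lower)
  define h :: "nat \<Rightarrow> real" where "h n = inverse (real (Suc n))" for n
  have h: "h n > 0" for n by (simp add: h_def)
  have "\<forall>n. \<exists>y. y \<in> D \<and> f y < \<mu> + h n"
    using cINF_less_iff[OF D(3) bdd] h unfolding \<mu>_def by (meson less_add_same_cancel1)
  from choice[OF this] obtain w where w: "\<And>n. w n \<in> D" "\<And>n. f (w n) < \<mu> + h n" by blast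
  \<comment> \<open>The midpoint has value at least \<mu>, and at most the average of the two values
    minus a quarter of the squared distance.\<close>
  have close: "(dist (w i) (w j))\<^sup>2 \<le> 2 * (h i + h j)" for i j
  proof -
    obtain m where m: "m \<in> D" "f m \<le> f (w i) / 2 + f (w j) / 2 - (dist (w i) (w j))\<^sup>2 / 4"
      using inner[OF w(1) w(1), of "1/2" i j] by auto
    then show ?thesis using m(2) \<mu>[OF m(1)] w(2)[of i] w(2)[of j] by (simp add: field_simps)
  qed
  have "Cauchy w"
  proof (rule metric_CauchyI)
    fix e :: real assume "e > 0"
    then have "e\<^sup>2 / 4 > 0" by simp
    then obtain N where N: "h N < e\<^sup>2 / 4" using reals_Archimedean unfolding h_def by blast
    have "dist (w i) (w j) < e" if "i \<ge> N" "j \<ge> N" for i j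
    proof -
      have "h i \<le> h N"
        "h j \<le> h N"
        using that unfolding h_def by (auto intro!: le_imp_inverse_le)
      then have "(dist (w i) (w j))\<^sup>2 < e\<^sup>2" using close[of i j] N by (simp add: field_simps)
      then show ?thesis using \<open>e > 0\<close> by (intro power_less_imp_less_base[of _ 2 e]) auto
    qed
    then show "\<exists>M. \<forall>m\<ge>M. \<forall>n\<ge>M. dist (w m) (w n) < e" by blast
  qed
  then obtain s where s: "w \<longlonglongrightarrow> s" using Cauchy_convergent convergent_def by blast
  have sD: "s \<in> D" using closed_sequentially[OF D(1) _ s] w(1) by blast
  have lim: "(\<lambda>n. f (w n)) \<longlonglongrightarrow> f s" using continuous_on_tendsto_compose[OF f(2) s] by simp
  have lim': "(\<lambda>n. \<mu> + h n) \<longlonglongrightarrow> \<mu> + 0"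
    unfolding h_def by (intro tendsto_add tendsto_const LIMSEQ_inverse_real_of_nat)
  have "f s \<le> \<mu> + 0" using w(2) by (intro LIMSEQ_le[OF lim lim']) (auto intro: less_imp_le)
  then have fs: "f s \<le> \<mu>" by simp
  have "f s + (dist s y)\<^sup>2 \<le> f y" if y: "y \<in> D" for y
  proof -
    \<comment> \<open>Compare \<open>s\<close> with the point of the segment to \<open>y\<close>
      that carries weight \<open>z\<close> at \<open>s\<close>, and cancel \<open>1 - z\<close>.
      Letting \<open>z\<close> tend to 1, so that the point approaches \<open>s\<close>, gives the
      full quadratic term.\<close>
    have "z * (dist s y)\<^sup>2 \<le> f y - f s" if z: "0 < z" "z < 1" for z
    proof -
      obtain m where m: "m \<in> D" "f m \<le> z * f s + (1 - z) * f y - (1 - z) * z * (dist s y)\<^sup>2"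
        using inner[OF sD y, of "1 - z"] z by auto
      then have "(1 - z) * (z * (dist s y)\<^sup>2) \<le> (1 - z) * (f y - f s)"
        using fs \<mu>[OF m(1)] by (simp add: algebra_simps)
      then show ?thesis using z by simp
    qed
    then have "(dist s y)\<^sup>2 \<le> f y - f s" by (rule field_le_mult_one_interval)
    then show ?thesis by simp
  qed
  then show ?thesis using sD by blast
qed

section \<open>Metric projections and Karcher means as minimizers\<close>

lemma geodesically_convex_UNIV: "geodesically_convex UNIV"
  by (simp add: geodesically_convex_def)

text \<open>The projection minimizes the squared distance to \<open>x\<close>; the growth term of
  the minimizer becomes the Pythagorean inequality, which also makes the definite description
  unambiguous.\<close>

lemma metric_projection:
  fixes D :: "'a::complete_space set"
  assumes cat: "CAT0 TYPE('a)" and D: "closed D" "geodesically_convex D" "D \<noteq> {}"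
  shows metric_projection_in: "metric_projection D x \<in> D"
    and metric_projection_pythagoras:
      "z \<in> D \<Longrightarrow> (dist x (metric_projection D x))\<^sup>2 + (dist (metric_projection D x) z)\<^sup>2 \<le> (dist x z)\<^sup>2"
proof -
  have cont: "continuous_on UNIV (\<lambda>y. (dist x y)\<^sup>2)" by (intro continuous_intros)
  have "\<exists>s\<in>D. \<forall>y\<in>D. (dist x s)\<^sup>2 + (dist s y)\<^sup>2 \<le> (dist x y)\<^sup>2"
    using CAT0_geodesic_space[OF cat] D CAT0_strongly_convex_dist[OF cat] cont
    by (rule strongly_convex_minimizer) simp
  then obtain s where s: "s \<in> D" "\<And>y. y \<in> D \<Longrightarrow> (dist x s)\<^sup>2 + (dist s y)\<^sup>2 \<le> (dist x y)\<^sup>2"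
    by blast
  have "metric_projection D x = s"
    unfolding metric_projection_def
  proof (rule the_equality)
    have "dist x s \<le> dist x z" if "z \<in> D" for z
      using power2_add_le_imp_le(1)[OF s(2)[OF that]] by simp
    then show "s \<in> D \<and> (\<forall>z\<in>D. dist x s \<le> dist x z)" using s(1) by blast
  next
    fix y assume y: "y \<in> D \<and> (\<forall>z\<in>D. dist x y \<le> dist x z)"
    then have "(dist x y)\<^sup>2 \<le> (dist x s)\<^sup>2" using s(1) by (simp add: power_mono)
    with s(2)[of y] y have "dist s y = 0" by (intro power2_add_le_imp_eq_0) auto
    then show "y = s" by simp
  qed
  then show "metric_projection D x \<in> D"
    "z \<in> D \<Longrightarrow> (dist x (metric_projection D x))\<^sup>2 + (dist (metric_projection D x) z)\<^sup>2 \<le> (dist x z)\<^sup>2"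
    using s by auto
qed

lemma metric_projection_decreases_dist:
  fixes D :: "'a::complete_space set"
  assumes "CAT0 TYPE('a)" "closed D" "geodesically_convex D" "z \<in> D"
  shows "dist (metric_projection D x) z \<le> dist x z"
proof -
  have "D \<noteq> {}" using assms(4) by blast
  then show ?thesis
    by (rule power2_add_le_imp_le(2)[OF metric_projection_pythagoras[OF assms(1-3) _ assms(4)] zero_le_dist])
qed

text \<open>The weights of the average sum to 1, so the quadratic term survives with the same
  constant. For \<open>n = 0\<close> the functional vanishes and this term would be lost.\<close>

lemma strongly_convex_karcher_functional:
  assumes cat: "CAT0 TYPE('a::metric_space)" and n: "n > 0"
  shows "strongly_convex (karcher_functional T n (x::'a))"
  unfolding strongly_convex_def
proof (intro allI impI, elim conjE)
  fix y w m :: 'a and S t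
  assume A: "geodesic_segment S y w" "m \<in> S" "0 \<le> t" "t \<le> 1" "dist y m = t * dist y w"
  let ?d = "\<lambda>i y. (dist ((T ^^ i) x) y)\<^sup>2"
  have "(\<Sum>i<n. ?d i m) \<le> (\<Sum>i<n. (1 - t) * ?d i y + t * ?d i w - t * (1 - t) * (dist y w)\<^sup>2)"
    by (intro sum_mono strongly_convexD[OF CAT0_strongly_convex_dist[OF cat] A])
  also have "\<dots> = (1 - t) * (\<Sum>i<n. ?d i y) + t * (\<Sum>i<n. ?d i w) - n * (t * (1 - t) * (dist y w)\<^sup>2)"
    by (simp add: sum.distrib sum_subtractf sum_distrib_left)
  finally show "karcher_functional T n x m \<le> (1 - t) * karcher_functional T n x y
      + t * karcher_functional T n x w - t * (1 - t) * (dist y w)\<^sup>2"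
    using n unfolding karcher_functional_def by (simp add: field_simps)
qed

text \<open>The source of all later estimates: a point whose Karcher functional exceeds the minimum
  by little must be close to the mean.\<close>

lemma karcher_mean_variance:
  fixes x :: "'a::complete_space"
  assumes cat: "CAT0 TYPE('a)" and n: "n > 0"
  shows "karcher_functional T n x (karcher_mean T n x) + (dist (karcher_mean T n x) y)\<^sup>2
    \<le> karcher_functional T n x y"
proof -
  let ?f = "karcher_functional T n x"
  have cont: "continuous_on UNIV ?f"
    unfolding karcher_functional_def by (intro continuous_intros)
  have nonneg: "0 \<le> ?f y" for y by (simp add: karcher_functional_def sum_nonneg)
  obtain s where s: "\<And>y. ?f s + (dist s y)\<^sup>2 \<le> ?f y"
    using strongly_convex_minimizer[OF CAT0_geodesic_space[OF cat] closed_UNIV geodesically_convex_UNIV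
        UNIV_not_empty strongly_convex_karcher_functional[OF cat n, of T x] cont nonneg] by auto
  have "karcher_mean T n x = s"
    unfolding karcher_mean_def
  proof (rule the_equality)
    show "\<forall>z. ?f s \<le> ?f z" using s by (meson add_increasing2 order_trans zero_le_power2 le_add_same_cancel1)
  next
    fix y assume "\<forall>z. ?f y \<le> ?f z"
    then have "(dist s y)\<^sup>2 \<le> 0" using s[of y] by (metis add_le_cancel_left add.right_neutral order_trans)
    then show "y = s" by simp
  qed
  then show ?thesis using s by simp
qed

section \<open>Asymptotic centers\<close>

lemma mem_asymptotic_center_iff:
  "z \<in> asymptotic_center u \<longleftrightarrow> (\<forall>y. asymptotic_radius_at z u \<le> asymptotic_radius_at y u)"
proof -
  have le: "asymptotic_radius u \<le> asymptotic_radius_at y u" for y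
    unfolding asymptotic_radius_def by (rule INF_lower) simp
  have "asymptotic_radius_at z u = asymptotic_radius u"
    if "\<forall>y. asymptotic_radius_at z u \<le> asymptotic_radius_at y u"
    using le[of z] that unfolding asymptotic_radius_def by (intro antisym INF_greatest) auto
  then show ?thesis using le by (auto simp: asymptotic_center_def)
qed

lemma mem_asymptotic_center_mono:
  assumes "z \<in> asymptotic_center u" "asymptotic_radius_at y u \<le> asymptotic_radius_at z u"
  shows "y \<in> asymptotic_center u"
  using assms unfolding mem_asymptotic_center_iff by (blast intro: order_trans)

text \<open>A vanishing error does not affect the limit superior. This is how further points are
  shown to belong to an asymptotic center.\<close>

lemma asymptotic_radius_at_mono:
  assumes "eventually (\<lambda>n. dist a (u n) \<le> dist b (u n) + e n) sequentially" "e \<longlonglongrightarrow> 0"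
  shows "asymptotic_radius_at a u \<le> asymptotic_radius_at b u"
proof -
  have "limsup (\<lambda>n. ereal (dist a (u n))) \<le> limsup (\<lambda>n. ereal (e n) + ereal (dist b (u n)))"
    using assms(1) by (intro Limsup_mono) (simp add: add.commute)
  also have "\<dots> = 0 + limsup (\<lambda>n. ereal (dist b (u n)))"
    using assms(2) by (intro ereal_limsup_lim_add) (auto simp: zero_ereal_def)
  finally show ?thesis by (simp add: asymptotic_radius_at_def)
qed

text \<open>Strong convexity of squared distances holds with the same constant along the whole
  sequence, so it passes to the squared limit superior. Its minimizer is then unique by quadratic
  growth.\<close>

lemma asymptotic_center_singleton:
  fixes u :: "nat \<Rightarrow> 'a::complete_space"
  assumes cat: "CAT0 TYPE('a)" and bdd: "bounded (range u)"
  obtains z where "asymptotic_center u = {z}"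
proof -
  \<comment> \<open>Boundedness of the sequence makes all radii finite, so the argument can proceed
    in the reals.\<close>
  define r where "r a = real_of_ereal (asymptotic_radius_at a u)" for a
  have r: "asymptotic_radius_at a u = ereal (r a)" and r_nonneg: "0 \<le> r a" for a
  proof -
    obtain B where "\<And>n. dist a (u n) \<le> B" using bdd bounded_any_center[of "range u" a] by auto
    then have "asymptotic_radius_at a u \<le> ereal B"
      unfolding asymptotic_radius_at_def by (intro Limsup_bounded) simp
    moreover have "0 \<le> asymptotic_radius_at a u"
      unfolding asymptotic_radius_at_def by (intro le_Limsup) (auto simp: always_eventually)
    ultimately show "asymptotic_radius_at a u = ereal (r a)" "0 \<le> r a"
      unfolding r_def by (cases "asymptotic_radius_at a u"; simp)+
  qed
  have r_less: "eventually (\<lambda>n. dist a (u n) < c) sequentially" if "r a < c" for a c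
    using r[of a] that Limsup_lessD[of sequentially "\<lambda>n. ereal (dist a (u n))" "ereal c"]
    by (simp add: asymptotic_radius_at_def)
  have r_le: "r a \<le> c" if "eventually (\<lambda>n. dist a (u n) \<le> c) sequentially" for a c
    using r[of a] that Limsup_bounded[of "\<lambda>n. ereal (dist a (u n))" "ereal c" sequentially]
    by (simp add: asymptotic_radius_at_def)
  have lip: "r a \<le> r b + dist a b" for a b
  proof (rule field_le_epsilon)
    fix e :: real assume "e > 0"
    then have "eventually (\<lambda>n. dist b (u n) < r b + e) sequentially" by (intro r_less) simp
    then have "eventually (\<lambda>n. dist a (u n) \<le> r b + dist a b + e) sequentially"
    proof eventually_elim
      case (elim n)
      then show ?case using dist_triangle[of a "u n" b] by simp
    qed
    then show "r a \<le> r b + dist a b + e" by (rule r_le)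
  qed
  have "1-lipschitz_on UNIV r"
  proof (rule lipschitz_onI)
    show "dist (r a) (r b) \<le> 1 * dist a b" for a b
      using lip[of a b] lip[of b a] by (simp add: dist_real_def abs_le_iff dist_commute)
  qed simp
  then have cont: "continuous_on UNIV (\<lambda>a. (r a)\<^sup>2)"
    by (intro continuous_intros lipschitz_on_continuous_on)
  have sc: "strongly_convex (\<lambda>a. (r a)\<^sup>2)"
    unfolding strongly_convex_def
  proof (intro allI impI, elim conjE)
    fix x y m :: 'a and S t
    assume A: "geodesic_segment S x y" "m \<in> S" "0 \<le> t" "t \<le> 1" "dist x m = t * dist x y"
    \<comment> \<open>The distances are eventually below \<open>r x + e\<close> and
      \<open>r y + e\<close> only for positive \<open>e\<close>; the slack is removed at the end by
      continuity of \<open>g\<close>.\<close>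
    define g where "g e = (1 - t) * (r x + e)\<^sup>2 + t * (r y + e)\<^sup>2 - t * (1 - t) * (dist x y)\<^sup>2" for e
    have "(r m)\<^sup>2 \<le> g e" if e: "e > 0" for e
    proof -
      have "eventually (\<lambda>n. dist x (u n) < r x + e \<and> dist y (u n) < r y + e) sequentially"
        using e by (intro eventually_conj r_less) auto
      then have ev: "eventually (\<lambda>n. (dist m (u n))\<^sup>2 \<le> g e) sequentially"
      proof eventually_elim
        case (elim n)
        then have "(dist (u n) x)\<^sup>2 \<le> (r x + e)\<^sup>2" "(dist (u n) y)\<^sup>2 \<le> (r y + e)\<^sup>2"
          by (auto simp: dist_commute intro: power_mono)
        then have "(1 - t) * (dist (u n) x)\<^sup>2 + t * (dist (u n) y)\<^sup>2 \<le>
            (1 - t) * (r x + e)\<^sup>2 + t * (r y + e)\<^sup>2"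
          using A(3,4) by (intro add_mono mult_left_mono) auto
        then show ?case
          using strongly_convexD[OF CAT0_strongly_convex_dist[OF cat, of "u n"] A]
          by (simp add: g_def dist_commute)
      qed
      then obtain n where "(dist m (u n))\<^sup>2 \<le> g e" by (auto simp: eventually_sequentially)
      then have ge: "0 \<le> g e" by (rule order_trans[OF zero_le_power2])
      have "eventually (\<lambda>n. dist m (u n) \<le> sqrt (g e)) sequentially"
        using ev by eventually_elim (rule real_le_rsqrt)
      then have "r m \<le> sqrt (g e)" by (rule r_le)
      then have "(r m)\<^sup>2 \<le> (sqrt (g e))\<^sup>2" using r_nonneg by (simp add: power_mono)
      then show ?thesis using ge by simp
    qed
    then have "eventually (\<lambda>e. (r m)\<^sup>2 \<le> g e) (at_right 0)"
      by (rule eventually_mono[OF eventually_at_right_less])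
    moreover have "(g \<longlongrightarrow> g 0) (at_right 0)"
      unfolding g_def by (intro tendsto_intros)
    ultimately have "(r m)\<^sup>2 \<le> g 0"
      by (intro tendsto_lowerbound[of g _ "at_right 0"]) auto
    then show "(r m)\<^sup>2 \<le> (1 - t) * (r x)\<^sup>2 + t * (r y)\<^sup>2 - t * (1 - t) * (dist x y)\<^sup>2"
      by (simp add: g_def)
  qed
  obtain z where z: "\<And>y. (r z)\<^sup>2 + (dist z y)\<^sup>2 \<le> (r y)\<^sup>2"
    using strongly_convex_minimizer[OF CAT0_geodesic_space[OF cat] closed_UNIV geodesically_convex_UNIV
        UNIV_not_empty sc cont] by auto
  have mem: "a \<in> asymptotic_center u \<longleftrightarrow> (\<forall>y. r a \<le> r y)" for a
    by (simp add: mem_asymptotic_center_iff r)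
  have "r z \<le> r y" for y
    by (rule power2_add_le_imp_le(1)[OF z r_nonneg])
  moreover have "a = z" if "\<forall>y. r a \<le> r y" for a
  proof -
    have "(r a)\<^sup>2 \<le> (r z)\<^sup>2" using that r_nonneg by (simp add: power_mono)
    with z[of a] have "dist z a = 0" by (rule power2_add_le_imp_eq_0)
    then show ?thesis by simp
  qed
  ultimately have "asymptotic_center u = {z}" using mem by blast
  then show thesis by (rule that)
qed

section \<open>Orbits of nonexpansive mappings\<close>

text \<open>The distances from \<open>T m\<close> to \<open>x\<close> and \<open>y\<close> are at
  most those from \<open>m\<close>. Strong convexity of the squared distance to \<open>T m\<close>
  then leaves no room for \<open>T m\<close> to differ from \<open>m\<close>.\<close>

lemma fixed_points_convex:
  fixes C :: "'a::metric_space set"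
  assumes cat: "CAT0 TYPE('a)" and C: "geodesically_convex C" and T: "nonexpansive_on C T"
  shows "geodesically_convex (fixed_points C T)"
  unfolding geodesically_convex_def
proof (intro ballI allI impI subsetI)
  fix x y S m
  assume x: "x \<in> fixed_points C T" and y: "y \<in> fixed_points C T"
    and S: "geodesic_segment S x y" and m: "m \<in> S"
  have mC: "m \<in> C" using C S m x y unfolding geodesically_convex_def fixed_points_def by blast
  obtain t where t: "0 \<le> t" "t \<le> 1" "dist x m = t * dist x y" "dist m y = (1 - t) * dist x y"
    using geodesic_segment_parameter[OF S m] .
  have "dist (T m) x \<le> t * dist x y" "dist (T m) y \<le> (1 - t) * dist x y"
    using T mC x y t unfolding nonexpansive_on_def fixed_points_def by (metis (mono_tags, lifting) dist_commute mem_Collect_eq)+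
  then have "(dist (T m) x)\<^sup>2 \<le> (t * dist x y)\<^sup>2" "(dist (T m) y)\<^sup>2 \<le> ((1 - t) * dist x y)\<^sup>2"
    by (auto intro: power_mono)
  then have "(1 - t) * (dist (T m) x)\<^sup>2 + t * (dist (T m) y)\<^sup>2 \<le>
      (1 - t) * (t * dist x y)\<^sup>2 + t * ((1 - t) * dist x y)\<^sup>2"
    using t by (intro add_mono mult_left_mono) auto
  also have "\<dots> = t * (1 - t) * (dist x y)\<^sup>2" by (simp add: power2_eq_square algebra_simps)
  finally have "(dist (T m) m)\<^sup>2 \<le> 0"
    using strongly_convexD[OF CAT0_strongly_convex_dist[OF cat, of "T m"] S m t(1-3)] by linarith
  then show "m \<in> fixed_points C T" using mC by (simp add: fixed_points_def)
qed

lemma fixed_points_closed: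
  fixes C :: "'a::metric_space set"
  assumes C: "closed C" and T: "nonexpansive_on C T"
  shows "closed (fixed_points C T)"
proof -
  have "1-lipschitz_on C T" using T by (auto simp: nonexpansive_on_def intro: lipschitz_onI)
  then have "continuous_on C T" by (rule lipschitz_on_continuous_on)
  then have "closed {a \<in> C. dist (T a) a = 0}"
    by (intro continuous_closed_preimage_constant continuous_on_dist continuous_on_id C)
  then show ?thesis by (simp add: fixed_points_def)
qed

lemma tendsto_zero_of_square_le:
  fixes d :: "nat \<Rightarrow> real"
  assumes "\<And>n. 0 \<le> d n" "\<And>n. (d n)\<^sup>2 \<le> K / real (Suc n)"
  shows "d \<longlonglongrightarrow> 0"
proof -
  have "(\<lambda>n. K * inverse (real (Suc n))) \<longlonglongrightarrow> K * 0"
    by (intro tendsto_intros LIMSEQ_inverse_real_of_nat)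
  then have "(\<lambda>n. (d n)\<^sup>2) \<longlonglongrightarrow> 0"
    using assms(2) by (intro tendsto_sandwich[of "\<lambda>_. 0" "\<lambda>n. (d n)\<^sup>2" _ "\<lambda>n. K / real (Suc n)"])
      (auto simp: divide_inverse)
  then have "(\<lambda>n. sqrt ((d n)\<^sup>2)) \<longlonglongrightarrow> sqrt 0" by (rule tendsto_real_sqrt)
  then show ?thesis using assms(1) by simp
qed

section \<open>An orbit, its projections onto the fixed points and its Karcher means\<close>

locale hadamard_nonexpansive =
  fixes C :: "'a::complete_space set" and T :: "'a \<Rightarrow> 'a" and x :: 'a
  assumes cat: "CAT0 TYPE('a)"
    and C: "closed C" "geodesically_convex C"
    and T: "T \<in> C \<rightarrow> C" "nonexpansive_on C T"
    and F_nonempty: "fixed_points C T \<noteq> {}"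
    and x: "x \<in> C"
begin

abbreviation "F \<equiv> fixed_points C T"
abbreviation "orb n \<equiv> (T ^^ n) x"
text \<open>The shift keeps the number of averaged points positive, as
  \<open>karcher_mean_variance\<close> requires.\<close>

abbreviation "\<sigma> n \<equiv> karcher_mean T (Suc n) x"

lemma orb_in: "orb n \<in> C"
  using x T(1) by (induction n) auto

lemma F_subset: "F \<subseteq> C"
  by (auto simp: fixed_points_def)

lemma T_dist: "a \<in> C \<Longrightarrow> b \<in> C \<Longrightarrow> dist (T a) (T b) \<le> dist a b"
  using T(2) unfolding nonexpansive_on_def by blast

lemmas F_closed = fixed_points_closed[OF C(1) T(2)]
lemmas F_convex = fixed_points_convex[OF cat C(2) T(2)]

text \<open>Fejer monotonicity: \<open>T\<close> fixes \<open>q\<close> and does not increase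
  distances.\<close>

lemma orb_dist_antimono:
  assumes q: "q \<in> F" and mn: "m \<le> n"
  shows "dist (orb n) q \<le> dist (orb m) q"
  using mn
proof (induction n rule: dec_induct)
  case (step n)
  have "dist (orb (Suc n)) q \<le> dist (orb n) q"
    using T_dist[OF orb_in, of q n] q by (auto simp: fixed_points_def)
  then show ?case using step.IH by simp
qed simp

text \<open>The squared distance \<open>a n\<close> of the orbit to \<open>F\<close> decreases and
  hence converges; the Pythagorean inequality bounds the squared distance between two projections by
  the drop of \<open>a\<close>.\<close>

lemma projection_orbit_converges:
  obtains p where "p \<in> F" "(\<lambda>n. metric_projection F (orb n)) \<longlonglongrightarrow> p"
proof -
  note pF = metric_projection_in[OF cat F_closed F_convex F_nonempty]
  note pyth = metric_projection_pythagoras[OF cat F_closed F_convex F_nonempty]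
  define P where "P n = metric_projection F (orb n)" for n
  define a where "a n = (dist (orb n) (P n))\<^sup>2" for n
  have P: "P n \<in> F" for n unfolding P_def by (rule pF)
  have le: "(dist (P m) (P n))\<^sup>2 \<le> a m - a n" if "m \<le> n" for m n
  proof -
    \<comment> \<open>The earlier projection \<open>P m\<close> competes with \<open>P n\<close> for
      the point of \<open>F\<close> nearest to \<open>orb n\<close>, and the orbit has not moved
      away from it since time \<open>m\<close>.\<close>
    have "a n + (dist (P n) (P m))\<^sup>2 \<le> (dist (orb n) (P m))\<^sup>2"
      unfolding a_def P_def[of n] by (rule pyth[OF P])
    also have "\<dots> \<le> a m"
      unfolding a_def by (intro power_mono orb_dist_antimono P that) simp
    finally show ?thesis by (simp add: dist_commute)
  qed
  have dec: "decseq a"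
    unfolding decseq_def
  proof (intro allI impI)
    fix m n :: nat assume "m \<le> n"
    then show "a n \<le> a m" using le[of m n] zero_le_power2[of "dist (P m) (P n)"] by linarith
  qed
  have "\<forall>n. 0 \<le> a n" by (simp add: a_def)
  with dec obtain L where "a \<longlonglongrightarrow> L" by (rule decseq_convergent)
  then have cauchy: "Cauchy a" by (rule LIMSEQ_imp_Cauchy)
  have "Cauchy P"
  proof (rule metric_CauchyI)
    fix e :: real assume e: "e > 0"
    then obtain N where N: "\<And>m n. N \<le> m \<Longrightarrow> N \<le> n \<Longrightarrow> dist (a m) (a n) < e\<^sup>2"
      using metric_CauchyD[OF cauchy, of "e\<^sup>2"] by auto
    have *: "dist (P m) (P n) < e" if "N \<le> m" "m \<le> n" for m n
    proof (rule power_less_imp_less_base)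
      show "(dist (P m) (P n))\<^sup>2 < e\<^sup>2"
        using le[OF that(2)] N[of m n] that by (simp add: dist_real_def)
    qed (use e in simp)
    have "dist (P m) (P n) < e" if "N \<le> m" "N \<le> n" for m n
      using *[of m n] *[of n m] that by (cases "m \<le> n") (auto simp: dist_commute)
    then show "\<exists>M. \<forall>m\<ge>M. \<forall>n\<ge>M. dist (P m) (P n) < e" by blast
  qed
  then obtain p where p: "P \<longlonglongrightarrow> p" using Cauchy_convergent convergent_def by blast
  then have "p \<in> F" using closed_sequentially[OF F_closed _ p] P by blast
  then show thesis using that p unfolding P_def by blast
qed

text \<open>In the variance inequality at \<open>q\<close>, drop the minimum of the functional,
  which is nonnegative, and bound each summand at \<open>q\<close> by Fejer monotonicity.\<close>

lemma karcher_mean_dist_fixed_point: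
  assumes q: "q \<in> F"
  shows "dist (\<sigma> n) q \<le> dist x q"
proof (rule power2_le_imp_le)
  have "(dist (\<sigma> n) q)\<^sup>2 \<le> karcher_functional T (Suc n) x q"
    using karcher_mean_variance[OF cat, of "Suc n" T x q]
      sum_nonneg[of "{..<Suc n}" "\<lambda>i. (dist (orb i) (\<sigma> n))\<^sup>2"]
    by (simp add: karcher_functional_def del: sum.lessThan_Suc)
       (smt (verit) divide_nonneg_nonneg of_nat_0_le_iff)
  also have "\<dots> \<le> (1 / real (Suc n)) * (\<Sum>i<Suc n. (dist x q)\<^sup>2)"
    unfolding karcher_functional_def
    using orb_dist_antimono[OF q, of 0] by (intro mult_left_mono sum_mono power_mono) auto
  also have "\<dots> = (dist x q)\<^sup>2" by simp
  finally show "(dist (\<sigma> n) q)\<^sup>2 \<le> (dist x q)\<^sup>2" .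
qed simp

text \<open>Projecting onto \<open>D\<close> increases at most the first \<open>N\<close> summands of the Karcher functional.
  For \<open>N = 0\<close> this says that the means lie in \<open>D\<close>.\<close>

lemma karcher_mean_dist_convex:
  assumes D: "closed D" "geodesically_convex D" and p: "p \<in> D" "p \<in> F"
    and orb: "\<And>i. N \<le> i \<Longrightarrow> orb i \<in> D"
  shows "(dist (\<sigma> n) (metric_projection D (\<sigma> n)))\<^sup>2 \<le> real N * (2 * dist x p)\<^sup>2 / real (Suc n)"
proof -
  define q where "q = metric_projection D (\<sigma> n)"
  define B where "B = (2 * dist x p)\<^sup>2"
  \<comment> \<open>A crude bound for the first \<open>N\<close> summands: both \<open>orb i\<close>
    and \<open>q\<close> lie within \<open>dist x p\<close> of \<open>p\<close>, the latter because
    projecting onto \<open>D\<close> does not move the mean away from \<open>p\<close>.\<close>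
  have summand_le: "(dist (orb i) q)\<^sup>2 \<le> B" for i
  proof -
    have "dist (orb i) q \<le> dist (orb i) p + dist q p" by (rule dist_triangle2)
    also have "dist (orb i) p \<le> dist x p" using orb_dist_antimono[OF p(2), of 0 i] by simp
    also have "dist q p \<le> dist (\<sigma> n) p"
      unfolding q_def by (rule metric_projection_decreases_dist[OF cat D p(1)])
    also have "dist (\<sigma> n) p \<le> dist x p" by (rule karcher_mean_dist_fixed_point[OF p(2)])
    finally show ?thesis unfolding B_def by (intro power_mono) auto
  qed
  have summand_decreases: "(dist (orb i) q)\<^sup>2 \<le> (dist (orb i) (\<sigma> n))\<^sup>2" if "N \<le> i" for i
    using metric_projection_decreases_dist[OF cat D orb[OF that], of "\<sigma> n"]
    unfolding q_def by (intro power_mono) (auto simp: dist_commute)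
  have "(\<Sum>i<Suc n. (dist (orb i) q)\<^sup>2)
      \<le> (\<Sum>i<Suc n. (dist (orb i) (\<sigma> n))\<^sup>2 + (if i < N then B else 0))"
    using summand_le summand_decreases by (intro sum_mono) (auto intro: add_increasing)
  also have "\<dots> = (\<Sum>i<Suc n. (dist (orb i) (\<sigma> n))\<^sup>2) + real (card ({..<Suc n} \<inter> {..<N})) * B"
    by (simp add: sum.distrib sum.If_cases lessThan_def Collect_conj_eq del: sum.lessThan_Suc)
  also have "real (card ({..<Suc n} \<inter> {..<N})) * B \<le> real N * B"
    unfolding B_def by (intro mult_right_mono) (auto intro: order_trans[OF card_mono[of "{..<N}"]])
  finally have "karcher_functional T (Suc n) x q
      \<le> karcher_functional T (Suc n) x (\<sigma> n) + real N * B / real (Suc n)"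
    unfolding karcher_functional_def
    by (simp add: field_simps del: sum.lessThan_Suc of_nat_Suc)
  \<comment> \<open>The projection is nearly as good a minimizer as the mean, so the variance
    inequality forces them together.\<close>
  then show ?thesis
    using karcher_mean_variance[OF cat, of "Suc n" T x q] unfolding q_def B_def by simp
qed

text \<open>The means are minimizers over the whole space, whereas \<open>T\<close> is controlled
  only on \<open>C\<close>. The whole orbit lies in \<open>C\<close>, so the preceding bound applies
  with \<open>N = 0\<close>.\<close>

lemma karcher_mean_in: "\<sigma> n \<in> C"
proof -
  obtain q where q: "q \<in> F" using F_nonempty by blast
  have "(dist (\<sigma> n) (metric_projection C (\<sigma> n)))\<^sup>2 \<le> 0"
    using karcher_mean_dist_convex[OF C _ q, of 0 n] q F_subset orb_in by auto
  then have "metric_projection C (\<sigma> n) = \<sigma> n" by simp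
  then show ?thesis using metric_projection_in[OF cat C, of "\<sigma> n"] x by force
qed

text \<open>Applying \<open>T\<close> matches the summand of index \<open>i + 1\<close> at the image
  with that of index \<open>i\<close> at the mean. Only the initial summand stays unmatched, and
  averaging divides it by the number of points.\<close>

lemma karcher_mean_dist_image:
  "(dist (\<sigma> n) (T (\<sigma> n)))\<^sup>2 \<le> (dist x (T (\<sigma> n)))\<^sup>2 / real (Suc n)"
proof -
  have "(\<Sum>i<Suc n. (dist (orb i) (T (\<sigma> n)))\<^sup>2)
      = (dist x (T (\<sigma> n)))\<^sup>2 + (\<Sum>i<n. (dist (orb (Suc i)) (T (\<sigma> n)))\<^sup>2)"
    by (subst sum.lessThan_Suc_shift) simp
  also have "\<dots> \<le> (dist x (T (\<sigma> n)))\<^sup>2 + (\<Sum>i<n. (dist (orb i) (\<sigma> n))\<^sup>2)"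
    using T_dist[OF orb_in karcher_mean_in] by (intro add_left_mono sum_mono power_mono) auto
  also have "\<dots> \<le> (dist x (T (\<sigma> n)))\<^sup>2 + (\<Sum>i<Suc n. (dist (orb i) (\<sigma> n))\<^sup>2)" by simp
  finally have "karcher_functional T (Suc n) x (T (\<sigma> n))
      \<le> karcher_functional T (Suc n) x (\<sigma> n) + (dist x (T (\<sigma> n)))\<^sup>2 / real (Suc n)"
    unfolding karcher_functional_def
    by (simp add: field_simps del: sum.lessThan_Suc of_nat_Suc)
  then show ?thesis using karcher_mean_variance[OF cat, of "Suc n" T x "T (\<sigma> n)"] by simp
qed

lemma karcher_mean_asymptotically_fixed: "(\<lambda>n. dist (\<sigma> n) (T (\<sigma> n))) \<longlonglongrightarrow> 0"
proof -
  obtain q where q: "q \<in> F" using F_nonempty by blast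
  \<comment> \<open>A fixed point makes the numerator independent of \<open>n\<close>.\<close>
  have "(dist (\<sigma> n) (T (\<sigma> n)))\<^sup>2 \<le> (2 * dist x q)\<^sup>2 / real (Suc n)" for n
  proof -
    have "dist x (T (\<sigma> n)) \<le> dist x q + dist (T (\<sigma> n)) q" by (rule dist_triangle2)
    also have "dist (T (\<sigma> n)) q \<le> dist (\<sigma> n) q"
      using T_dist[OF karcher_mean_in, of q] q by (auto simp: fixed_points_def)
    also have "dist (\<sigma> n) q \<le> dist x q" by (rule karcher_mean_dist_fixed_point[OF q])
    finally have "(dist x (T (\<sigma> n)))\<^sup>2 \<le> (2 * dist x q)\<^sup>2" by (intro power_mono) auto
    then show ?thesis
      using karcher_mean_dist_image[of n] by (meson divide_right_mono of_nat_0_le_iff order_trans)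
  qed
  then show ?thesis by (intro tendsto_zero_of_square_le) auto
qed

section \<open>Asymptotic centers of subsequences of the means\<close>

lemma bounded_karcher_means: "bounded (range \<sigma>)"
  using F_nonempty karcher_mean_dist_fixed_point
  by (metis (no_types, lifting) bounded_def dist_commute ex_in_conv rangeE)

text \<open>A demiclosedness argument: neither the projection of \<open>z\<close> onto
  \<open>C\<close> nor, afterwards, \<open>T z\<close> has a larger asymptotic radius than
  \<open>z\<close>, so uniqueness of the center identifies both with \<open>z\<close>.\<close>

lemma asymptotic_center_fixed_point:
  assumes k: "strict_mono k" and z: "asymptotic_center (\<sigma> \<circ> k) = {z}"
  shows "z \<in> F"
proof -
  have min: "y = z" if "asymptotic_radius_at y (\<sigma> \<circ> k) \<le> asymptotic_radius_at z (\<sigma> \<circ> k)" for y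
    using that z mem_asymptotic_center_mono[of z "\<sigma> \<circ> k" y] by simp
  \<comment> \<open>Membership of \<open>z\<close> in \<open>C\<close> comes first, since
    nonexpansiveness at \<open>z\<close> depends on it.\<close>
  have "metric_projection C z = z"
    using metric_projection_decreases_dist[OF cat C karcher_mean_in]
    by (intro min asymptotic_radius_at_mono[where e = "\<lambda>_. 0"]) auto
  then have zC: "z \<in> C" using metric_projection_in[OF cat C, of z] x by force
  have "T z = z"
  proof (intro min asymptotic_radius_at_mono[where e = "\<lambda>n. dist (\<sigma> (k n)) (T (\<sigma> (k n)))"])
    have "dist (T z) (\<sigma> n) \<le> dist z (\<sigma> n) + dist (\<sigma> n) (T (\<sigma> n))" for n
      using dist_triangle2[of "T z" "\<sigma> n" "T (\<sigma> n)"] T_dist[OF zC karcher_mean_in, of n] by simp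
    then show "\<forall>\<^sub>F n in sequentially.
        dist (T z) ((\<sigma> \<circ> k) n) \<le> dist z ((\<sigma> \<circ> k) n) + dist (\<sigma> (k n)) (T (\<sigma> (k n)))" by simp
    show "(\<lambda>n. dist (\<sigma> (k n)) (T (\<sigma> (k n)))) \<longlonglongrightarrow> 0"
      using LIMSEQ_subseq_LIMSEQ[OF karcher_mean_asymptotically_fixed k] by (simp add: comp_def)
  qed
  then show ?thesis using zC by (simp add: fixed_points_def)
qed

lemma asymptotic_center_eq_projection_limit:
  assumes Q4: "Q4_bar TYPE('a)"
    and p: "p \<in> F" "(\<lambda>n. metric_projection F (orb n)) \<longlonglongrightarrow> p"
    and k: "strict_mono k" and z: "asymptotic_center (\<sigma> \<circ> k) = {z}"
  shows "z = p"
proof (rule ccontr)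
  assume "z \<noteq> p"
  then have \<delta>: "dist p z > 0" by simp
  have zF: "z \<in> F" using asymptotic_center_fixed_point[OF k z] .
  define P where "P n = metric_projection F (orb n)" for n
  define D where "D = {y. dist p y \<le> dist z y}"
  have D: "closed D" unfolding D_def by (intro closed_Collect_le continuous_intros)
  \<comment> \<open>Here the \<open>Q4_bar\<close> condition enters: it states exactly that such
    half-spaces are convex.\<close>
  have D_convex: "geodesically_convex D"
    unfolding geodesically_convex_def
  proof (intro ballI allI impI subsetI)
    fix a b S m
    assume "a \<in> D" "b \<in> D" "geodesic_segment S a b" "m \<in> S"
    then have "dist p m \<le> dist m z"
      using Q4 unfolding Q4_bar_def by (simp add: D_def dist_commute[of z])
    then show "m \<in> D" by (simp add: D_def dist_commute)
  qed
  have pD: "p \<in> D" by (simp add: D_def)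
  have "eventually (\<lambda>n. orb n \<in> D) sequentially"
  proof -
    \<comment> \<open>The square of \<open>dist (orb n) (P n) + dist (P n) p\<close> bounds the
      squared distance to \<open>p\<close> from above, and the Pythagorean inequality bounds the one
      to \<open>z\<close> from below. With \<open>dist x z\<close> bounding the factor
      \<open>dist (orb n) (P n)\<close> of the cross term, their gap is at least this expression,
      whose limit is positive.\<close>
    have lim: "(\<lambda>n. (dist (P n) z)\<^sup>2 - 2 * dist x z * dist (P n) p - (dist (P n) p)\<^sup>2)
        \<longlonglongrightarrow> (dist p z)\<^sup>2 - 2 * dist x z * dist p p - (dist p p)\<^sup>2"
      using p(2) unfolding P_def by (intro tendsto_intros)
    have "eventually (\<lambda>n. (dist (P n) z)\<^sup>2 - 2 * dist x z * dist (P n) p - (dist (P n) p)\<^sup>2 > 0) sequentially"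
      using \<delta> by (intro order_tendstoD(1)[OF lim]) simp
    then show ?thesis
    proof eventually_elim
      case (elim n)
      have pyth: "(dist (orb n) (P n))\<^sup>2 + (dist (P n) z)\<^sup>2 \<le> (dist (orb n) z)\<^sup>2"
        unfolding P_def by (rule metric_projection_pythagoras[OF cat F_closed F_convex F_nonempty zF])
      have "dist (orb n) (P n) \<le> dist (orb n) z"
        by (rule power2_add_le_imp_le(1)[OF pyth zero_le_dist])
      also have "\<dots> \<le> dist x z" using orb_dist_antimono[OF zF, of 0 n] by simp
      finally have "2 * dist (orb n) (P n) * dist (P n) p \<le> 2 * dist x z * dist (P n) p"
        by (intro mult_right_mono) auto
      then have le: "(dist (orb n) (P n))\<^sup>2 + (dist (P n) p)\<^sup>2 + 2 * dist (orb n) (P n) * dist (P n) p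
          \<le> (dist (orb n) (P n))\<^sup>2 + (dist (P n) z)\<^sup>2"
        using elim by linarith
      have "(dist (orb n) p)\<^sup>2 \<le> (dist (orb n) (P n) + dist (P n) p)\<^sup>2"
        by (intro power_mono dist_triangle) simp
      also have "\<dots> \<le> (dist (orb n) z)\<^sup>2"
        unfolding power2_sum by (rule order_trans[OF le pyth])
      finally have "(dist (orb n) p)\<^sup>2 \<le> (dist (orb n) z)\<^sup>2" .
      then have "dist (orb n) p \<le> dist (orb n) z" by (rule power2_le_imp_le) simp
      then show ?case by (simp add: D_def dist_commute)
    qed
  qed
  then obtain N where N: "\<And>i. N \<le> i \<Longrightarrow> orb i \<in> D" unfolding eventually_sequentially by blast
  define \<pi> where "\<pi> n = metric_projection D (\<sigma> n)" for n
  have "(\<lambda>n. dist (\<sigma> n) (\<pi> n)) \<longlonglongrightarrow> 0"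
    using karcher_mean_dist_convex[OF D D_convex pD p(1) N] unfolding \<pi>_def
    by (intro tendsto_zero_of_square_le) auto
  then have "(\<lambda>n. 2 * dist (\<sigma> (k n)) (\<pi> (k n))) \<longlonglongrightarrow> 2 * 0"
    using LIMSEQ_subseq_LIMSEQ[OF _ k] by (intro tendsto_intros) (force simp: comp_def)
  \<comment> \<open>The factor 2 arises from passing from the mean to its projection, where
    \<open>p\<close> is at least as near as \<open>z\<close>, and back.\<close>
  moreover have "dist p (\<sigma> n) \<le> dist z (\<sigma> n) + 2 * dist (\<sigma> n) (\<pi> n)" for n
  proof -
    have "\<pi> n \<in> D" using metric_projection_in[OF cat D D_convex] pD unfolding \<pi>_def by blast
    then have "dist p (\<pi> n) \<le> dist z (\<pi> n)" by (simp add: D_def)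
    then show ?thesis
      using dist_triangle2[of p "\<sigma> n" "\<pi> n"] dist_triangle[of z "\<pi> n" "\<sigma> n"] by simp
  qed
  ultimately have "asymptotic_radius_at p (\<sigma> \<circ> k) \<le> asymptotic_radius_at z (\<sigma> \<circ> k)"
    by (intro asymptotic_radius_at_mono[where e = "\<lambda>n. 2 * dist (\<sigma> (k n)) (\<pi> (k n))"]) auto
  then have "p \<in> asymptotic_center (\<sigma> \<circ> k)"
    using z mem_asymptotic_center_mono[of z "\<sigma> \<circ> k" p] by simp
  then show False using z \<open>z \<noteq> p\<close> by simp
qed

end

theorem theorem1p2:
  fixes C :: "'a::complete_space set" and T :: "'a \<Rightarrow> 'a" and x :: 'a
  assumes "CAT0 TYPE('a)"
    and "Q4_bar TYPE('a)"
    and "C \<noteq> {}" and "closed C" and "geodesically_convex C"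
    and "T \<in> C \<rightarrow> C" and "nonexpansive_on C T"
    and "fixed_points C T \<noteq> {}"
    and "x \<in> C"
  shows "\<exists>p \<in> fixed_points C T.
           Delta_mean_convergent T x p \<and>
           (\<lambda>n. metric_projection (fixed_points C T) ((T ^^ n) x)) \<longlonglongrightarrow> p"
proof -
  interpret hadamard_nonexpansive C T x
    using assms by unfold_locales
  obtain p where p: "p \<in> F" "(\<lambda>n. metric_projection F (orb n)) \<longlonglongrightarrow> p"
    by (rule projection_orbit_converges)
  \<comment> \<open>Since \<open>p\<close> was obtained from the orbit before any subsequence is
    chosen, all subsequences of the means share the same center.\<close>
  have "asymptotic_center (\<sigma> \<circ> k) = {p}" if k: "strict_mono k" for k
  proof -
    have "bounded (range (\<sigma> \<circ> k))"
      by (rule bounded_subset[OF bounded_karcher_means]) auto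
    then obtain z where z: "asymptotic_center (\<sigma> \<circ> k) = {z}"
      by (rule asymptotic_center_singleton[OF cat])
    then show ?thesis
      using asymptotic_center_eq_projection_limit[OF assms(2) p k z] by simp
  qed
  then have "Delta_mean_convergent T x p"
    unfolding Delta_mean_convergent_def Delta_converges_def using bounded_karcher_means by blast
  then show ?thesis using p by blast
qed

end
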